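(* Let $(X,\nu)$ be a Menger's 2-probabilistic normed space and let $A$ be a nonempty subset of $X$. Then $A$ is $\mathcal{D}$-bounded if and only if there exists a distribution function $G\in\mathcal{D}^+$ such that $\nu_{x,y}\ge G$ (pointwise) for every $x,y\in A$.
   Context: A distribution function is a nondecreasing function $F:[-\infty,+\infty]\to[0,1]$ that is left-continuous on $\mathbb{R}$ with $F(-\infty)=0$, $F(+\infty)=1$. $\mathcal{D}$ denotes the set of proper distribution functions, i.e. those with $\lim_{x\to-\infty}F(x)=0$ and $\lim_{x\to+\infty}F(x)=1$. $\mathcal{D}^+$ is the set of $F\in\mathcal{D}$ with $F(0)=0$. A Menger's 2-probabilistic normed space is a pair $(X,\nu)$ where $X$ is a real vector space with $\dim X>1$ and $\nu:X\times X\to\mathcal{D}$, $(x,y)\mapsto\nu_{x,y}$, satisfies: (A1) $\nu_{x,y}(0)=0$ for all $x,y\in X$; (A2) $\nu_{x,y}(t)=1$ for all $t>0$ if and only if $x,y$ are linearly dependent; (A3) $\nu_{x,y}(t)=\nu_{y,x}(t)$ for all $x,y\in X$, $t\in\mathbb{R}$; (A4) $\nu_{\alpha x,y}(t)=\nu_{x,y}(t/|\alpha|)$ for all $\alpha\in\mathbb{R}\setminus\{0\}$, $x,y\in X$, $t\in\mathbb{R}$; (A5) $\nu_{x+y,z}(s+t)\ge\min\{\nu_{x,z}(s),\nu_{y,z}(t)\}$ for all $x,y,z\in X$, $s,t\in\mathbb{R}$. For a function $f$, $\ell^-f(x)$ denotes the left limit of $f$ at $x$; $\ell^-f(+\infty)=\lim_{x\to+\infty}f(x)$.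 For nonempty $A\subseteq X$ put $\varphi_A(t)=\inf\{\nu_{x,y}(t):x,y\in A\}$. The probabilistic radius $R_A$ is defined by $R_A(x)=\ell^-\varphi_A(x)$ for $x\in[0,+\infty)$ and $R_A(+\infty)=1$. $A$ is certainly bounded if $R_A(x_0)=1$ for some $x_0\in(0,\infty)$; $A$ is perhaps bounded if $R_A(x)<1$ for every $x\in(0,\infty)$ and $\ell^-R_A(+\infty)=1$. $A$ is $\mathcal{D}$-bounded if it is certainly bounded or perhaps bounded. *)

theory Defs
  imports Complex_Main "HOL-Library.Extended_Real"
begin

definition distribution_function :: "(ereal \<Rightarrow> real) \<Rightarrow> bool" where
  "distribution_function F \<longleftrightarrow>
     mono F \<and> range F \<subseteq> {0..1} \<and>
     (\<forall>x::real. continuous (at_left (ereal x)) F) \<and>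
     F (-\<infinity>) = 0 \<and> F \<infinity> = 1"

definition proper_dfs :: "(ereal \<Rightarrow> real) set"  (\<open>\<D>\<close>) where
  "\<D> = {F. distribution_function F \<and>
           (F \<longlongrightarrow> 0) (at_right (-\<infinity>)) \<and> (F \<longlongrightarrow> 1) (at_left \<infinity>)}"

definition proper_dfs_plus :: "(ereal \<Rightarrow> real) set"  (\<open>\<D>\<^sup>+\<close>) where
  "\<D>\<^sup>+ = {F \<in> \<D>. F 0 = 0}"

text \<open>
  Linear dependence of the pair (family) \<open>x, y\<close>.  This is not the library's
  \<open>dependent {x, y}\<close>: for \<open>x = y \<noteq> 0\<close> the set \<open>{x, y}\<close> is an independent singleton,
  whereas the pair is linearly dependent.
\<close>
definition linearly_dependent_pair :: "'a::real_vector \<Rightarrow> 'a \<Rightarrow> bool" where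
  "linearly_dependent_pair x y \<longleftrightarrow>
     (\<exists>a b. (a \<noteq> 0 \<or> b \<noteq> 0) \<and> a *\<^sub>R x + b *\<^sub>R y = 0)"

text \<open>
  The vector space \<open>X\<close> is the whole type \<open>'a\<close>.  It may be infinite-dimensional, and the
  library's \<open>dim\<close> is \<open>0\<close> in that case, so \<open>dim X > 1\<close> is stated through a Hamel basis.
\<close>
locale menger_2_pn_space =
  fixes \<nu> :: "'a::real_vector \<Rightarrow> 'a \<Rightarrow> ereal \<Rightarrow> real"
  assumes dim_gt_1:
      "\<exists>B::'a set. independent B \<and> span B = UNIV \<and> (infinite B \<or> card B > 1)"
    and proper: "\<nu> x y \<in> \<D>"
    and A1: "\<nu> x y 0 = 0"
    and A2: "(\<forall>t::real. t > 0 \<longrightarrow> \<nu> x y (ereal t) = 1) \<longleftrightarrow> linearly_dependent_pair x y"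
    and A3: "\<nu> x y (ereal t) = \<nu> y x (ereal t)"
    and A4: "\<alpha> \<noteq> 0 \<Longrightarrow> \<nu> (\<alpha> *\<^sub>R x) y (ereal t) = \<nu> x y (ereal (t / \<bar>\<alpha>\<bar>))"
    and A5: "\<nu> (x + y) z (ereal (s + t)) \<ge> min (\<nu> x z (ereal s)) (\<nu> y z (ereal t))"

text \<open>
  At \<open>x = \<infinity>\<close> the filter \<open>at_left \<infinity>\<close> on \<^typ>\<open>ereal\<close> excludes the point \<open>\<infinity>\<close>, so this
  is the limit of \<open>f\<close> as its argument tends to \<open>+\<infinity>\<close>.
\<close>
definition left_lim :: "(ereal \<Rightarrow> real) \<Rightarrow> ereal \<Rightarrow> real" where
  "left_lim f x = Lim (at_left x) f"

definition inf_profile ::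
    "('a::real_vector \<Rightarrow> 'a \<Rightarrow> ereal \<Rightarrow> real) \<Rightarrow> 'a set \<Rightarrow> ereal \<Rightarrow> real" where
  "inf_profile \<nu> A t = Inf {\<nu> x y t | x y. x \<in> A \<and> y \<in> A}"

text \<open>The domain of the radius is \<open>[0, \<infinity>]\<close>; values at negative arguments are irrelevant.\<close>
definition prob_radius ::
    "('a::real_vector \<Rightarrow> 'a \<Rightarrow> ereal \<Rightarrow> real) \<Rightarrow> 'a set \<Rightarrow> ereal \<Rightarrow> real" where
  "prob_radius \<nu> A x = (if x = \<infinity> then 1 else left_lim (inf_profile \<nu> A) x)"

definition certainly_bounded ::
    "('a::real_vector \<Rightarrow> 'a \<Rightarrow> ereal \<Rightarrow> real) \<Rightarrow> 'a set \<Rightarrow> bool" where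
  "certainly_bounded \<nu> A \<longleftrightarrow> (\<exists>x::real. x > 0 \<and> prob_radius \<nu> A (ereal x) = 1)"

definition perhaps_bounded ::
    "('a::real_vector \<Rightarrow> 'a \<Rightarrow> ereal \<Rightarrow> real) \<Rightarrow> 'a set \<Rightarrow> bool" where
  "perhaps_bounded \<nu> A \<longleftrightarrow>
     (\<forall>x::real. x > 0 \<longrightarrow> prob_radius \<nu> A (ereal x) < 1) \<and>
     left_lim (prob_radius \<nu> A) \<infinity> = 1"

definition D_bounded ::
    "('a::real_vector \<Rightarrow> 'a \<Rightarrow> ereal \<Rightarrow> real) \<Rightarrow> 'a set \<Rightarrow> bool" where
  "D_bounded \<nu> A \<longleftrightarrow> certainly_bounded \<nu> A \<or> perhaps_bounded \<nu> A"

end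

theory Submission
  imports Defs
begin

text \<open>
  The radius of \<open>A\<close> is the largest distribution function below all \<open>\<nu> x y\<close> with \<open>x, y \<in> A\<close>:
  it lies below the infimum \<open>\<phi>\<close>, and left continuity puts any other minorant below the left limit
  of \<open>\<phi>\<close>.  By monotonicity, certainly or perhaps bounded together say exactly that the radius
  tends to \<open>1\<close> at \<open>\<infinity>\<close>, which is properness.
\<close>

section \<open>Left limits of monotone functions\<close>

text \<open>A value close to the supremum is attained at some \<open>z < x\<close>, and monotonicity
  carries it over to all points between \<open>z\<close> and \<open>x\<close>. The point
  \<open>y\<close> makes \<open>{..<x}\<close> nonempty and lets \<open>at_left x\<close> be
  described by intervals.\<close>

lemma tendsto_at_left_Sup:
  fixes f :: "'a::linorder_topology \<Rightarrow> real"
  assumes "mono f" and "bdd_above (range f)" and "y < x"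
  shows "(f \<longlongrightarrow> (SUP z\<in>{..<x}. f z)) (at_left x)"
proof (rule order_tendstoI)
  have bdd: "bdd_above (f ` {..<x})"
    using assms(2) by (rule bdd_above_mono) auto
  fix a
  show "\<forall>\<^sub>F z in at_left x. a < f z" if less: "a < (SUP z\<in>{..<x}. f z)"
  proof -
    have "{..<x} \<noteq> {}"
      using \<open>y < x\<close> by auto
    then obtain z where "z < x" "a < f z"
      using less less_cSUP_iff[OF _ bdd] by auto
    then show ?thesis
      unfolding eventually_at_left[OF \<open>z < x\<close>]
      using \<open>a < f z\<close> \<open>z < x\<close> monoD[OF \<open>mono f\<close> less_imp_le]
      by (blast intro: less_le_trans)
  qed
  show "\<forall>\<^sub>F z in at_left x. f z < a" if "(SUP z\<in>{..<x}. f z) < a"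
    unfolding eventually_at_left[OF \<open>y < x\<close>]
    using that bdd \<open>y < x\<close> by (meson cSUP_upper lessThan_iff le_less_trans)
qed

text \<open>\<open>Lim\<close> is a definite description, so limits must be unique before
  \<open>left_lim\<close> can be evaluated. The order on \<open>ereal\<close> is dense, which makes
  the filter nontrivial.\<close>

lemma at_left_neq_bot_ereal:
  fixes x :: ereal
  assumes "-\<infinity> < x"
  shows "at_left x \<noteq> bot"
  unfolding trivial_limit_def eventually_at_left[OF assms]
  using dense by blast

lemma left_lim_eqI:
  assumes "(f \<longlongrightarrow> l) (at_left x)" and "-\<infinity> < x"
  shows "left_lim f x = l"
  unfolding left_lim_def using assms at_left_neq_bot_ereal by (intro tendsto_Lim)

lemma left_lim_eq_Sup:
  assumes "mono f" and "bdd_above (range f)" and "-\<infinity> < x"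
  shows "left_lim f x = (SUP z\<in>{..<x}. f z)"
  using assms by (intro left_lim_eqI tendsto_at_left_Sup)

lemma SUP_lessThan_le_iff:
  fixes f :: "ereal \<Rightarrow> real"
  assumes "bdd_above (range f)" and "-\<infinity> < x"
  shows "(SUP z\<in>{..<x}. f z) \<le> c \<longleftrightarrow> (\<forall>z<x. f z \<le> c)"
proof -
  have "bdd_above (f ` {..<x})"
    using assms(1) by (rule bdd_above_mono) auto
  with assms(2) show ?thesis
    by (subst cSUP_le_iff) auto
qed

locale radius_of_set = menger_2_pn_space \<nu>
  for \<nu> :: "'a::real_vector \<Rightarrow> 'a \<Rightarrow> ereal \<Rightarrow> real" +
  fixes A :: "'a set"
  assumes nonempty: "A \<noteq> {}"
begin

abbreviation "\<phi> \<equiv> inf_profile \<nu> A"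
abbreviation "R \<equiv> prob_radius \<nu> A"

section \<open>The pointwise infimum over pairs from \<open>A\<close>\<close>

lemma nu_mono: "mono (\<nu> x y)"
  and nu_bounds: "0 \<le> \<nu> x y t" "\<nu> x y t \<le> 1"
  and nu_PInf: "\<nu> x y \<infinity> = 1"
  using proper[of x y] by (auto simp: proper_dfs_def distribution_function_def image_subset_iff)

lemma inf_profile_le:
  assumes "x \<in> A" "y \<in> A"
  shows "\<phi> t \<le> \<nu> x y t"
  unfolding inf_profile_def using assms nu_bounds
  by (intro cInf_lower) (auto intro: bdd_belowI[of _ 0])

text \<open>The reals are only conditionally complete: a lower bound lies below \<open>Inf\<close>
  because \<open>A\<close>, and with it the set of values, is nonempty.\<close>

lemma inf_profile_greatest:
  assumes "\<And>x y. x \<in> A \<Longrightarrow> y \<in> A \<Longrightarrow> c \<le> \<nu> x y t"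
  shows "c \<le> \<phi> t"
proof -
  obtain a where "a \<in> A"
    using nonempty by blast
  then have "\<nu> a a t \<in> {\<nu> x y t |x y. x \<in> A \<and> y \<in> A}"
    by blast
  then have "{\<nu> x y t |x y. x \<in> A \<and> y \<in> A} \<noteq> {}"
    by (metis empty_iff)
  then show ?thesis
    unfolding inf_profile_def by (rule cInf_greatest) (use assms in blast)
qed

lemma mono_inf_profile: "mono \<phi>"
proof (rule monoI)
  fix s t :: ereal
  assume "s \<le> t"
  then show "\<phi> s \<le> \<phi> t"
    using inf_profile_le monoD[OF nu_mono] by (intro inf_profile_greatest) (rule order_trans)
qed

lemma inf_profile_bounds: "0 \<le> \<phi> t" "\<phi> t \<le> 1"
proof -
  show "0 \<le> \<phi> t"
    by (simp add: inf_profile_greatest nu_bounds)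
  show "\<phi> t \<le> 1"
    using nonempty inf_profile_le nu_bounds(2) by (meson ex_in_conv order_trans)
qed

lemma bdd_above_inf_profile: "bdd_above (range \<phi>)"
  using inf_profile_bounds(2) by (rule bdd_aboveI2)

lemma inf_profile_nonpos:
  assumes "t \<le> 0"
  shows "\<phi> t = 0"
proof -
  obtain a where "a \<in> A"
    using nonempty by blast
  then have "\<phi> t \<le> \<nu> a a 0"
    using inf_profile_le monoD[OF nu_mono assms] order_trans by blast
  with A1 inf_profile_bounds(1)[of t] show ?thesis
    by simp
qed

section \<open>The radius as a supremum\<close>

lemma prob_radius_eq_Sup:
  assumes "-\<infinity> < x" "x < \<infinity>"
  shows "R x = (SUP z\<in>{..<x}. \<phi> z)"
  using assms left_lim_eq_Sup[OF mono_inf_profile bdd_above_inf_profile]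
  by (simp add: prob_radius_def)

text \<open>Reduces upper bounds on the radius to bounds on \<open>\<phi>\<close> at strictly
  earlier points, so that later arguments avoid limits.\<close>

lemma prob_radius_le_iff:
  assumes "-\<infinity> < x" "x < \<infinity>"
  shows "R x \<le> c \<longleftrightarrow> (\<forall>z<x. \<phi> z \<le> c)"
  using assms by (simp add: prob_radius_eq_Sup SUP_lessThan_le_iff bdd_above_inf_profile)

lemma inf_profile_le_prob_radius:
  assumes "z < x"
  shows "\<phi> z \<le> R x"
proof (cases "x = \<infinity>")
  case False
  moreover have "-\<infinity> < x"
    using assms by (rule le_less_trans[rotated]) simp
  ultimately show ?thesis
    using assms prob_radius_le_iff[of x "R x"] by simp
qed (simp add: prob_radius_def inf_profile_bounds)

lemma prob_radius_le_inf_profile: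
  assumes "-\<infinity> < x" "x < \<infinity>"
  shows "R x \<le> \<phi> x"
  using assms monoD[OF mono_inf_profile] by (simp add: prob_radius_le_iff)

lemma prob_radius_bounds:
  assumes "-\<infinity> < x"
  shows "0 \<le> R x" "R x \<le> 1"
proof -
  show "0 \<le> R x"
    using inf_profile_le_prob_radius[OF assms] inf_profile_bounds(1) order_trans by blast
  show "R x \<le> 1"
    using assms prob_radius_le_iff inf_profile_bounds(2)
    by (cases "x = \<infinity>") (auto simp: prob_radius_def less_le)
qed

text \<open>The radius has a junk value at \<open>-\<infinity>\<close>, where \<^term>\<open>at_left\<close> is the trivial filter.\<close>

definition G :: "ereal \<Rightarrow> real" where
  "G t = (if t = -\<infinity> then 0 else R t)"

section \<open>The radius as a distribution function\<close>

lemma G_le_nu: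
  assumes "x \<in> A" "y \<in> A"
  shows "G t \<le> \<nu> x y t"
proof (cases t)
  case (real r)
  then show ?thesis
    using assms prob_radius_le_inf_profile[of t] inf_profile_le[of x y t] by (simp add: G_def)
qed (auto simp: G_def prob_radius_def nu_PInf nu_bounds)

lemma G_bounds: "0 \<le> G t" "G t \<le> 1"
  using prob_radius_bounds[of t] by (auto simp: G_def less_le)

lemma mono_G: "mono G"
proof (rule monoI)
  fix s t :: ereal
  assume "s \<le> t"
  consider "s = -\<infinity>" | "t = \<infinity>" | "-\<infinity> < s" "t < \<infinity>"
    by (auto simp: less_le)
  then show "G s \<le> G t"
  proof cases
    case 3
    moreover from 3 \<open>s \<le> t\<close> have "s < \<infinity>" "-\<infinity> < t"
      by (meson le_less_trans less_le_trans)+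
    ultimately show ?thesis
      using prob_radius_le_iff[of s "R t"] inf_profile_le_prob_radius[of _ t] \<open>s \<le> t\<close>
      by (auto simp: G_def)
  qed (use G_bounds in \<open>auto simp: G_def prob_radius_def\<close>)
qed

lemma bdd_above_G: "bdd_above (range G)"
  using G_bounds(2) by (rule bdd_aboveI2)

lemma G_nonpos:
  assumes "t \<le> 0"
  shows "G t = 0"
proof (cases t)
  case (real r)
  have "\<phi> z \<le> 0" if "z < t" for z
    using inf_profile_nonpos[of z] that assms by (simp add: order_trans[OF less_imp_le])
  then show ?thesis
    using real prob_radius_le_iff[of t 0] G_bounds(1)[of t] by (simp add: G_def)
qed (use assms in \<open>auto simp: G_def\<close>)

text \<open>Passing to left limits a second time changes nothing: the values of \<open>G\<close>
  before \<open>x\<close> have the same supremum as those of \<open>\<phi>\<close>.\<close>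

lemma continuous_at_left_G: "continuous (at_left (ereal x)) G"
proof -
  have "(SUP z\<in>{..<ereal x}. G z) = G (ereal x)"
  proof (rule antisym)
    show "(SUP z\<in>{..<ereal x}. G z) \<le> G (ereal x)"
      using monoD[OF mono_G] by (simp add: SUP_lessThan_le_iff bdd_above_G)
    have "\<phi> z \<le> (SUP z\<in>{..<ereal x}. G z)" if "z < ereal x" for z
    proof -
      \<comment> \<open>The bound by the radius needs a strictly later point, and \<open>w\<close>
        is one that still lies before \<open>x\<close>.\<close>
      obtain w where "z < w" "w < ereal x"
        using \<open>z < ereal x\<close> dense by blast
      then have "\<phi> z \<le> G w"
        using inf_profile_le_prob_radius by (auto simp: G_def)
      also have "\<dots> \<le> (SUP z\<in>{..<ereal x}. G z)"
        using \<open>w < ereal x\<close> SUP_lessThan_le_iff[OF bdd_above_G, of "ereal x"] by auto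
      finally show ?thesis .
    qed
    then show "G (ereal x) \<le> (SUP z\<in>{..<ereal x}. G z)"
      by (simp add: G_def prob_radius_le_iff)
  qed
  then show ?thesis
    using tendsto_at_left_Sup[OF mono_G bdd_above_G, of "-\<infinity>" "ereal x"]
    by (simp add: continuous_within)
qed

lemma distribution_function_G: "distribution_function G"
  unfolding distribution_function_def
proof (intro conjI)
  show "G (-\<infinity>) = 0" "G \<infinity> = 1"
    by (simp_all add: G_def prob_radius_def)
qed (use mono_G G_bounds continuous_at_left_G in auto)

text \<open>The limit at \<open>-\<infinity>\<close> is automatic, since \<open>G\<close> vanishes
  at all nonpositive arguments.\<close>

lemma G_in_proper_dfs_plus:
  assumes "(G \<longlongrightarrow> 1) (at_left \<infinity>)"
  shows "G \<in> \<D>\<^sup>+"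
proof -
  have "\<forall>\<^sub>F t in at_right (-\<infinity>). G t = 0"
    by (subst eventually_at_right[of _ 0]) (auto simp: G_nonpos intro!: exI[of _ 0])
  then have "(G \<longlongrightarrow> 0) (at_right (-\<infinity>))"
    by (rule tendsto_eventually)
  then show ?thesis
    using assms distribution_function_G
    by (simp add: proper_dfs_plus_def proper_dfs_def G_nonpos)
qed

section \<open>Boundedness as a limit at infinity\<close>

text \<open>The two functions can differ only at \<open>-\<infinity>\<close>, so limits at
  \<open>\<infinity>\<close> transfer between them.\<close>

lemma eventually_G_eq_prob_radius: "\<forall>\<^sub>F t in at_left \<infinity>. G t = R t"
  by (subst eventually_at_left[of 0]) (auto simp: G_def intro!: exI[of _ 0])

lemma D_bounded_iff_tendsto: "D_bounded \<nu> A \<longleftrightarrow> (G \<longlongrightarrow> 1) (at_left \<infinity>)"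
proof
  assume "D_bounded \<nu> A"
  then consider x where "x > 0" "R (ereal x) = 1" | "left_lim R \<infinity> = 1"
    by (auto simp: D_bounded_def certainly_bounded_def perhaps_bounded_def)
  then show "(G \<longlongrightarrow> 1) (at_left \<infinity>)"
  proof cases
    case 1
    have "G t = 1" if "ereal x < t" for t
      using monoD[OF mono_G, of "ereal x" t] that 1 G_bounds(2)[of t] by (simp add: G_def)
    then have "\<forall>\<^sub>F t in at_left \<infinity>. G t = 1"
      by (subst eventually_at_left[of "ereal x"]) (auto intro!: exI[of _ "ereal x"])
    then show ?thesis
      by (rule tendsto_eventually)
  next
    case 2
    \<comment> \<open>The equation for \<open>left_lim\<close> alone does not assert convergence.
      Monotonicity of \<open>G\<close> supplies a limit, which the equation then identifies as
      1.\<close>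
    have lim: "(G \<longlongrightarrow> (SUP z\<in>{..<\<infinity>}. G z)) (at_left \<infinity>)"
      by (rule tendsto_at_left_Sup[OF mono_G bdd_above_G, of "-\<infinity>"]) simp
    then have "(R \<longlongrightarrow> (SUP z\<in>{..<\<infinity>}. G z)) (at_left \<infinity>)"
      using tendsto_cong[OF eventually_G_eq_prob_radius] by blast
    then have "(SUP z\<in>{..<\<infinity>}. G z) = 1"
      using 2 left_lim_eqI by fastforce
    with lim show ?thesis
      by simp
  qed
next
  assume "(G \<longlongrightarrow> 1) (at_left \<infinity>)"
  then have "(R \<longlongrightarrow> 1) (at_left \<infinity>)"
    using tendsto_cong[OF eventually_G_eq_prob_radius] by blast
  then have "left_lim R \<infinity> = 1"
    by (rule left_lim_eqI) simp
  \<comment> \<open>As the radius never exceeds 1, it either equals 1 at some positive real or stays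
    below 1 at all of them; these are the two kinds of boundedness.\<close>
  moreover have "R (ereal x) \<le> 1" for x
    by (rule prob_radius_bounds) simp
  ultimately show "D_bounded \<nu> A"
    unfolding D_bounded_def certainly_bounded_def perhaps_bounded_def
    by (meson antisym_conv2 order_le_less)
qed

text \<open>For real \<open>t\<close> and \<open>z < t\<close>,
  \<open>H z \<le> \<phi> z \<le> G t\<close>; letting \<open>z\<close> tend to \<open>t\<close>
  from the left gives the bound on \<open>H t\<close>. At the infinite points both functions take
  the same prescribed values.\<close>

lemma le_G:
  assumes "distribution_function H"
    and le: "\<And>x y t. x \<in> A \<Longrightarrow> y \<in> A \<Longrightarrow> H t \<le> \<nu> x y t"
  shows "H t \<le> G t"
proof (cases t)
  case (real r)
  have "(H \<longlongrightarrow> H t) (at_left t)"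
    using assms(1) real by (auto simp: distribution_function_def continuous_within)
  moreover have "\<forall>\<^sub>F z in at_left t. H z \<le> G t"
  proof (subst eventually_at_left[of "-\<infinity>"])
    have "H z \<le> G t" if "z < t" for z
      using le inf_profile_greatest[of "H z" z] inf_profile_le_prob_radius[OF that] real
      by (fastforce simp: G_def)
    then show "\<exists>b<t. \<forall>z>b. z < t \<longrightarrow> H z \<le> G t"
      using real by (intro exI[of _ "-\<infinity>"]) auto
  qed (use real in auto)
  ultimately show ?thesis
    using real by (intro tendsto_upperbound[OF _ _ at_left_neq_bot_ereal]) auto
qed (use assms(1) in \<open>auto simp: distribution_function_def G_def prob_radius_def\<close>)

text \<open>\<open>G\<close> itself is the witness in one direction. In the other, \<open>G\<close>
  is squeezed between \<open>H\<close> and the constant 1.\<close>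

lemma D_bounded_iff: "D_bounded \<nu> A \<longleftrightarrow> (\<exists>H \<in> \<D>\<^sup>+. \<forall>x \<in> A. \<forall>y \<in> A. \<forall>t. H t \<le> \<nu> x y t)"
proof
  assume "D_bounded \<nu> A"
  then show "\<exists>H \<in> \<D>\<^sup>+. \<forall>x \<in> A. \<forall>y \<in> A. \<forall>t. H t \<le> \<nu> x y t"
    using G_in_proper_dfs_plus G_le_nu D_bounded_iff_tendsto by blast
next
  assume "\<exists>H \<in> \<D>\<^sup>+. \<forall>x \<in> A. \<forall>y \<in> A. \<forall>t. H t \<le> \<nu> x y t"
  then obtain H where "distribution_function H" and lim: "(H \<longlongrightarrow> 1) (at_left \<infinity>)"
    and "\<And>x y t. x \<in> A \<Longrightarrow> y \<in> A \<Longrightarrow> H t \<le> \<nu> x y t"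
    by (auto simp: proper_dfs_plus_def proper_dfs_def)
  then have "H t \<le> G t" for t
    using le_G by blast
  then have "(G \<longlongrightarrow> 1) (at_left \<infinity>)"
    using G_bounds(2) by (intro tendsto_sandwich[OF _ _ lim tendsto_const]) auto
  then show "D_bounded \<nu> A"
    using D_bounded_iff_tendsto by blast
qed

end

theorem theorem2p6:
  fixes \<nu> :: "'a::real_vector \<Rightarrow> 'a \<Rightarrow> ereal \<Rightarrow> real"
    and A :: "'a set"
  assumes "menger_2_pn_space \<nu>"
    and "A \<noteq> {}"
  shows "D_bounded \<nu> A \<longleftrightarrow>
           (\<exists>G \<in> \<D>\<^sup>+. \<forall>x \<in> A. \<forall>y \<in> A. \<forall>t. G t \<le> \<nu> x y t)"
proof -
  interpret menger_2_pn_space \<nu>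
    by fact
  interpret radius_of_set \<nu> A
    by unfold_locales fact
  show ?thesis
    by (rule D_bounded_iff)
qed

end
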